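(* Let $n\ge 1$, let $P=\sum_{s\in\mathbb S}p_s\delta_s$ be a discrete probability distribution on $\mathbb S$, let $X_1,\dots,X_n,X_{n+1}$ be i.i.d. from $P$, and let $h:\mathbb S\to[J]:=\{1,\dots,J\}$ be a fixed hash function. Let $\mathbf C_J=(C_1,\dots,C_J)$ with $C_j=\sum_{i=1}^n I[h(X_i)=j]$ be the sketch of $X_1,\dots,X_n$, and let $\mathbf c=(c_1,\dots,c_J)$ be its observed value. For $j\in[J]$ set $\mathbb S_j:=\{s\in\mathbb S: h(s)=j\}$ and $q_j:=\Pr[h(X_i)=j\mid h]=\sum_{s\in\mathbb S_j}p_s$, with $q_j>0$. Then the $X_i$'s hashed into the $j$-th bucket, i.e. $\{X_i: h(X_i)=j\}$, are i.i.d. with distribution $P_j=\sum_{s\in\mathbb S_j}\frac{p_s}{q_j}\delta_s$. Further, for every $j\in[J]$ and $r\in\{0,1,\dots,c_j\}$, $$\pi_j(r;P,h):=\Pr[f_{X_{n+1}}=r\mid \mathbf C_J=\mathbf c,\,h(X_{n+1})=j,\,h]=\binom{c_j}{r}\sum_{s\in\mathbb S_j}\left(\frac{p_s}{q_j}\right)^{r+1}\left(1-\frac{p_s}{q_j}\right)^{c_j-r},$$ where $f_{X_{n+1}}:=\sum_{i=1}^n I[X_i=X_{n+1}]$.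
   Context: $I[\cdot]$ is the indicator function. "i.i.d. with distribution $P_j$" is meant conditionally on which indices $i$ satisfy $h(X_i)=j$. Conditioning on $h$ means that the hash function is treated as fixed (deterministic); in general it is drawn independently of the data. The convention $0^0=1$ is used. *)

theory Defs
  imports "HOL-Probability.Probability"
begin

definition iid_family :: "'w measure \<Rightarrow> (nat \<Rightarrow> 'w \<Rightarrow> 's) \<Rightarrow> nat set \<Rightarrow> 's measure \<Rightarrow> bool" where
  "iid_family M X I N \<longleftrightarrow>
     prob_space.indep_vars M (\<lambda>_. N) X I \<and> (\<forall>i\<in>I. distr M N (X i) = N)"

definition bucket :: "('s \<Rightarrow> nat) \<Rightarrow> nat \<Rightarrow> 's set" where
  "bucket h j = {s. h s = j}"

definition bucket_mass :: "'s pmf \<Rightarrow> ('s \<Rightarrow> nat) \<Rightarrow> nat \<Rightarrow> real" where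
  "bucket_mass P h j = (\<Sum>\<^sub>\<infinity>s\<in>bucket h j. pmf P s)"

text \<open>A weighted sum of Dirac measures, with the power set as sigma-algebra, is the measure
  whose density with respect to the counting measure is the weight function.\<close>

definition bucket_law :: "'s pmf \<Rightarrow> ('s \<Rightarrow> nat) \<Rightarrow> nat \<Rightarrow> 's measure" where
  "bucket_law P h j =
     density (count_space UNIV)
       (\<lambda>s. if s \<in> bucket h j then ennreal (pmf P s / bucket_mass P h j) else 0)"

definition sketch :: "('s \<Rightarrow> nat) \<Rightarrow> (nat \<Rightarrow> 'w \<Rightarrow> 's) \<Rightarrow> nat \<Rightarrow> nat \<Rightarrow> 'w \<Rightarrow> nat" where
  "sketch h X n j \<omega> = (\<Sum>i=1..n. of_bool (h (X i \<omega>) = j))"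

definition new_freq :: "(nat \<Rightarrow> 'w \<Rightarrow> 's) \<Rightarrow> nat \<Rightarrow> 'w \<Rightarrow> nat" where
  "new_freq X n \<omega> = (\<Sum>i=1..n. of_bool (X i \<omega> = X (n + 1) \<omega>))"

text \<open>On an uncountable symbol space the event that two symbols coincide need not be measurable,
  so \<^const>\<open>new_freq\<close> may fail to be a random variable; on a countable one this cannot happen.\<close>

lemma measurable_new_freq:
  fixes X :: "nat \<Rightarrow> 'w \<Rightarrow> 's"
  assumes meas: "\<And>i. i \<in> {1..n+1} \<Longrightarrow> X i \<in> measurable M (count_space UNIV)"
    and S: "countable S" "\<And>\<omega>. \<omega> \<in> space M \<Longrightarrow> X (n + 1) \<omega> \<in> S"
  shows "new_freq X n \<in> measurable M (count_space UNIV)"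
proof -
  have [measurable]: "Measurable.pred M (\<lambda>\<omega>. X i \<omega> = X (n + 1) \<omega>)" if "i \<in> {1..n}" for i
  proof -
    have [measurable]: "X i \<in> measurable M (count_space UNIV)"
      "X (n + 1) \<in> measurable M (count_space UNIV)"
      using that by (auto intro!: meas)
    have "Measurable.pred M (\<lambda>\<omega>. \<exists>s\<in>S. X i \<omega> = s \<and> X (n + 1) \<omega> = s)"
      using S(1) by measurable
    also have "?this \<longleftrightarrow> ?thesis"
      by (rule measurable_cong) (use S(2) in fastforce)
    finally show ?thesis .
  qed
  have "(\<lambda>\<omega>. \<Sum>i=1..n. of_bool (X i \<omega> = X (n + 1) \<omega>)) \<in> measurable M (count_space (UNIV :: nat set))"
    unfolding of_bool_def by measurable
  then show ?thesis
    by (simp add: new_freq_def[abs_def])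
qed

end

theory Submission imports Defs begin

text \<open>The event that the sketch equals \<open>c\<close> is the finite disjoint union, over the maps \<open>g\<close> whose
  fibres have the sizes \<open>c k\<close>, of the boxes \<open>h (X i) = g i\<close>. Fixing in addition the set \<open>R\<close> of the
  indices with \<open>X i = s\<close> still leaves a box; relative to \<open>g\<close> alone its probability changes by the
  factor \<open>(p / q) ^ r * (1 - p / q) ^ (c j - r)\<close> with \<open>r = card R\<close>, where \<open>p\<close> is the mass of \<open>s\<close> and
  \<open>q\<close> that of its bucket, and there are \<open>c j choose r\<close> such sets. Neither the factor nor the number
  depends on \<open>g\<close>, so the probability of the sketch cancels on conditioning, and summing over the
  countably many atoms \<open>s\<close> of the bucket gives the formula.\<close>

section \<open>Countable sums and conditioned pmfs\<close>

text \<open>Countable additivity in the form of an \<open>infsum\<close>, which is how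
  \<open>bucket_mass\<close> and the final formula express their sums. Since the measure is finite,
  the integral over \<open>count_space I\<close> is finite; hence the family is absolutely summable
  and the integral is the sum.\<close>

lemma (in finite_measure) measure_UN_infsum:
  assumes I: "countable I"
    and sets: "\<And>i. i \<in> I \<Longrightarrow> A i \<in> sets M"
    and disj: "disjoint_family_on A I"
  shows "measure M (\<Union>i\<in>I. A i) = (\<Sum>\<^sub>\<infinity>i\<in>I. measure M (A i))"
proof -
  have eq: "(\<integral>\<^sup>+i. ennreal (measure M (A i)) \<partial>count_space I) = emeasure M (\<Union>i\<in>I. A i)"
    by (simp add: emeasure_UN_countable[OF sets I disj] emeasure_eq_measure[symmetric])
  then have summable: "Infinite_Set_Sum.abs_summable_on (\<lambda>i. measure M (A i)) I"
    unfolding abs_summable_on_def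
    by (intro integrableI_nonneg) (auto simp: emeasure_eq_measure top.not_eq_extremum)
  have "measure M (\<Union>i\<in>I. A i) = infsetsum (\<lambda>i. measure M (A i)) I"
    unfolding infsetsum_def by (simp add: integral_eq_nn_integral eq Sigma_Algebra.measure_def[of M "\<Union>i\<in>I. A i"])
  also have "\<dots> = (\<Sum>\<^sub>\<infinity>i\<in>I. measure M (A i))"
    by (rule infsetsum_infsum[OF summable])
  finally show ?thesis .
qed

lemma measure_pmf_conv_infsum: "measure (measure_pmf P) A = (\<Sum>\<^sub>\<infinity>s\<in>A. pmf P s)"
  by (simp add: measure_pmf_conv_infsetsum infsetsum_infsum pmf_abs_summable)

lemma bucket_mass_eq_measure: "bucket_mass P h j = measure (measure_pmf P) (bucket h j)"
  by (simp add: bucket_mass_def measure_pmf_conv_infsum)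

lemma set_pmf_Int_bucket_nonempty:
  assumes "0 < bucket_mass P h j"
  shows "set_pmf P \<inter> bucket h j \<noteq> {}"
  using assms by (metis bucket_mass_eq_measure inf_commute less_irrefl measure_empty measure_Int_set_pmf)

text \<open>Both measures have the same density with respect to the counting measure; positivity of
  the mass makes the conditioned pmf meaningful. The bucket law is thereby seen to be a probability
  measure.\<close>

lemma bucket_law_eq_cond_pmf:
  assumes "0 < bucket_mass P h j"
  shows "bucket_law P h j = measure_pmf (cond_pmf P (bucket h j))"
  unfolding bucket_law_def measure_pmf_eq_density[of "cond_pmf P (bucket h j)"]
  by (intro arg_cong2[where f=density] refl ext)
     (simp add: pmf_cond[OF set_pmf_Int_bucket_nonempty[OF assms]] bucket_mass_eq_measure)

lemma measure_cond_pmf: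
  assumes "set_pmf P \<inter> B \<noteq> {}"
  shows "measure (measure_pmf (cond_pmf P B)) F
    = measure (measure_pmf P) (B \<inter> F) / measure (measure_pmf P) B"
  unfolding cond_pmf.rep_eq[OF assms]
  by (rule measure_uniform_measure) (auto simp: emeasure_measure_pmf_not_zero[OF assms])

section \<open>Independence as a product formula on boxes\<close>

text \<open>Every subset is measurable in the discrete sigma-algebra, so the sides
  \<open>F i\<close> may be arbitrary: one-element \<open>K\<close> gives the laws of the
  coordinates, larger \<open>K\<close> gives independence. In this form the property passes at once
  to subsets of \<open>I\<close>.\<close>

lemma iid_family_measure_pmf_iff:
  fixes X :: "nat \<Rightarrow> 'w \<Rightarrow> 's"
  assumes "prob_space M" "finite I"
  shows "iid_family M X I (measure_pmf P) \<longleftrightarrow>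
    (\<forall>i\<in>I. X i \<in> measurable M (count_space UNIV)) \<and>
    (\<forall>K F. K \<subseteq> I \<longrightarrow>
      measure M {\<omega>\<in>space M. \<forall>i\<in>K. X i \<omega> \<in> F i} = (\<Prod>i\<in>K. measure (measure_pmf P) (F i)))"
    (is "?L \<longleftrightarrow> ?X \<and> ?R")
proof -
  interpret prob_space M by fact
  \<comment> \<open>The empty \<open>K\<close> is kept apart: the intersection over it is
    \<open>UNIV\<close>, whereas the box over it is \<open>space M\<close>.\<close>
  have INT: "(\<Inter>i\<in>K. X i -` F i \<inter> space M) = {\<omega>\<in>space M. \<forall>i\<in>K. X i \<omega> \<in> F i}"
    if "K \<noteq> {}" for K F
    using that by auto
  show ?thesis
  proof (intro iffI conjI allI impI)
    assume L: ?L
    then show X: ?X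
      by (auto simp: iid_family_def indep_vars_def2)
    fix K and F :: "nat \<Rightarrow> 's set" assume K: "K \<subseteq> I"
    show "prob {\<omega>\<in>space M. \<forall>i\<in>K. X i \<omega> \<in> F i} = (\<Prod>i\<in>K. measure (measure_pmf P) (F i))"
    proof (cases "K = {}")
      case True
      then show ?thesis by (simp add: prob_space)
    next
      case False
      have "prob (\<Inter>i\<in>K. X i -` F i \<inter> space M) = (\<Prod>i\<in>K. prob (X i -` F i \<inter> space M))"
        using L False K assms(2)
        by (intro indep_varsD[of "\<lambda>_. measure_pmf P" X I])
           (auto simp: iid_family_def intro: finite_subset)
      also have "\<dots> = (\<Prod>i\<in>K. measure (measure_pmf P) (F i))"
      proof (rule prod.cong[OF refl])
        fix i assume "i \<in> K"
        with K L X have "distr M (measure_pmf P) (X i) = measure_pmf P"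
          "X i \<in> measurable M (measure_pmf P)"
          by (auto simp: iid_family_def)
        then show "prob (X i -` F i \<inter> space M) = measure (measure_pmf P) (F i)"
          by (metis measure_distr UNIV_I sets_measure_pmf)
      qed
      finally show ?thesis using INT[OF False] by simp
    qed
  next
    assume "?X \<and> ?R"
    then have X: ?X and R: ?R by auto
    have single: "prob (X i -` F \<inter> space M) = measure (measure_pmf P) F" if "i \<in> I" for i F
      using R[rule_format, of "{i}" "\<lambda>_. F"] that by (simp add: vimage_def Int_def conj_commute)
    have "indep_vars (\<lambda>_. measure_pmf P) X I"
      unfolding indep_vars_def2
    proof (intro conjI ballI indep_setsI)
      fix A K assume K: "K \<noteq> {}" "K \<subseteq> I" "finite K"
        and A: "\<forall>i\<in>K. A i \<in> {X i -` A \<inter> space M |A. A \<in> sets (measure_pmf P)}"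
      then obtain F where F: "\<And>i. i \<in> K \<Longrightarrow> A i = X i -` F i \<inter> space M"
        by simp metis
      have "prob (\<Inter>i\<in>K. A i) = prob (\<Inter>i\<in>K. X i -` F i \<inter> space M)"
        using F by simp
      also have "\<dots> = (\<Prod>i\<in>K. measure (measure_pmf P) (F i))"
        unfolding INT[OF K(1)] using R K(2) by blast
      also have "\<dots> = (\<Prod>i\<in>K. prob (A i))"
        using F K(2) single by (intro prod.cong) auto
      finally show "prob (\<Inter>i\<in>K. A i) = (\<Prod>i\<in>K. prob (A i))" .
    qed (use X in auto)
    moreover have "distr M (measure_pmf P) (X i) = measure_pmf P" if "i \<in> I" for i
    proof (rule measure_eqI)
      fix F assume "F \<in> sets (distr M (measure_pmf P) (X i))"
      then show "emeasure (distr M (measure_pmf P) (X i)) F = emeasure (measure_pmf P) F"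
        using X that single[OF that, of F]
        by (simp add: emeasure_distr emeasure_eq_measure measure_pmf.emeasure_eq_measure)
    qed simp
    ultimately show ?L
      by (simp add: iid_family_def)
  qed
qed

text \<open>The conditioning event is itself a box: the coordinates in \<open>I\<close> lie in the
  bucket, the others in \<open>A\<close> outside it. A further box over
  \<open>K \<subseteq> I\<close> shrinks only the sides in \<open>K\<close>, so in the quotient of
  the two products just the conditional probabilities of \<open>F i\<close> given the bucket, for
  \<open>i \<in> K\<close>, remain.\<close>

lemma iid_family_uniform_measure_bucket:
  fixes X :: "nat \<Rightarrow> 'w \<Rightarrow> 's"
  assumes "prob_space M" "finite A"
    and iid: "iid_family M X A (measure_pmf P)"
    and q: "0 < bucket_mass P h j"
    and pos: "0 < \<P>(\<omega> in M. {i\<in>A. h (X i \<omega>) = j} = I)"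
  shows "iid_family (uniform_measure M {\<omega>\<in>space M. {i\<in>A. h (X i \<omega>) = j} = I}) X I
    (bucket_law P h j)"
proof -
  interpret prob_space M by fact
  define B where "B = bucket h j"
  define E where "E = {\<omega>\<in>space M. {i\<in>A. h (X i \<omega>) = j} = I}"
  define G where "G i = (if i \<in> I then B else - B)" for i
  note iff = iid_family_measure_pmf_iff[OF assms(1,2), THEN iffD1, OF iid]
  have X[measurable]: "X i \<in> measurable M (count_space UNIV)" if "i \<in> A" for i
    using iff that by blast
  have prod: "prob {\<omega>\<in>space M. \<forall>i\<in>A. X i \<omega> \<in> F i} = (\<Prod>i\<in>A. measure (measure_pmf P) (F i))" for F
    using iff by blast
  \<comment> \<open>If \<open>I\<close> were not contained in \<open>A\<close>, the event would be
    empty; positivity excludes this.\<close>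
  have "E \<noteq> {}" using pos by (auto simp: E_def[symmetric])
  then have IA: "I \<subseteq> A" by (auto simp: E_def)
  have E_eq: "E = {\<omega>\<in>space M. \<forall>i\<in>A. X i \<omega> \<in> G i}"
    using IA by (auto simp: E_def G_def B_def bucket_def)
  have meas: "{\<omega>\<in>space M. \<forall>i\<in>K. X i \<omega> \<in> F i} \<in> events" if "K \<subseteq> A" for K F
  proof -
    have [measurable]: "Measurable.pred M (\<lambda>\<omega>. X i \<omega> \<in> F i)" if "i \<in> K" for i
      using that \<open>K \<subseteq> A\<close> by (intro measurable_compose[OF X]) auto
    have "finite K" using \<open>K \<subseteq> A\<close> assms(2) by (rule finite_subset)
    then show ?thesis by measurable
  qed
  have E[measurable]: "E \<in> events" unfolding E_eq by (rule meas) simp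
  have pE: "0 < prob E" using pos by (simp add: E_def)
  have ne: "set_pmf P \<inter> B \<noteq> {}"
    unfolding B_def by (rule set_pmf_Int_bucket_nonempty[OF q])
  have E0: "emeasure M E \<noteq> 0" "emeasure M E \<noteq> \<infinity>" using pE by (auto simp: emeasure_eq_measure)
  have ps: "prob_space (uniform_measure M E)"
    using E0 by (rule prob_space_uniform_measure)
  have "measure (uniform_measure M E) {\<omega>\<in>space M. \<forall>i\<in>K. X i \<omega> \<in> F i}
      = (\<Prod>i\<in>K. measure (measure_pmf (cond_pmf P B)) (F i))" if K: "K \<subseteq> I" for K F
  proof -
    define H where "H i = (if i \<in> K then G i \<inter> F i else G i)" for i
    have "E \<inter> {\<omega>\<in>space M. \<forall>i\<in>K. X i \<omega> \<in> F i} = {\<omega>\<in>space M. \<forall>i\<in>A. X i \<omega> \<in> H i}"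
      using K IA unfolding E_eq by (fastforce simp: H_def split: if_splits)
    moreover have "measure (uniform_measure M E) {\<omega>\<in>space M. \<forall>i\<in>K. X i \<omega> \<in> F i}
        = prob (E \<inter> {\<omega>\<in>space M. \<forall>i\<in>K. X i \<omega> \<in> F i}) / prob E"
      using K IA by (intro measure_uniform_measure E0 meas) auto
    ultimately have "measure (uniform_measure M E) {\<omega>\<in>space M. \<forall>i\<in>K. X i \<omega> \<in> F i}
        = (\<Prod>i\<in>A. measure (measure_pmf P) (H i)) / (\<Prod>i\<in>A. measure (measure_pmf P) (G i))"
      by (simp add: E_eq prod)
    also have "\<dots> = (\<Prod>i\<in>A. measure (measure_pmf P) (H i) / measure (measure_pmf P) (G i))"
      by (simp add: prod_dividef)
    also have "\<dots> = (\<Prod>i\<in>K. measure (measure_pmf P) (H i) / measure (measure_pmf P) (G i))"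
    proof (rule prod.mono_neutral_right)
      \<comment> \<open>This product is \<open>prob E\<close>. Its positivity keeps every
        \<open>G i\<close> from being null, so outside \<open>K\<close>, where
        \<open>H i = G i\<close>, the quotients are 1 rather than \<open>0 / 0 = 0\<close>.\<close>
      have "(\<Prod>i\<in>A. measure (measure_pmf P) (G i)) \<noteq> 0"
        using pE by (simp add: E_eq prod)
      then show "\<forall>i\<in>A - K. measure (measure_pmf P) (H i) / measure (measure_pmf P) (G i) = 1"
        using assms(2) by (auto simp: H_def prod_zero_iff)
    qed (use K IA assms(2) in auto)
    also have "\<dots> = (\<Prod>i\<in>K. measure (measure_pmf (cond_pmf P B)) (F i))"
      using K by (intro prod.cong) (auto simp: H_def G_def measure_cond_pmf[OF ne])
    finally show ?thesis .
  qed
  then have "iid_family (uniform_measure M E) X I (measure_pmf (cond_pmf P B))"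
    using ps finite_subset[OF IA assms(2)] IA
    by (subst iid_family_measure_pmf_iff) (auto intro!: X)
  then show ?thesis
    by (simp add: bucket_law_eq_cond_pmf[OF q] B_def E_def)
qed

section \<open>Sketches and hash patterns\<close>

lemma sketch_eq_card: "sketch h X n k \<omega> = card {i\<in>{1..n}. h (X i \<omega>) = k}"
  unfolding sketch_def of_bool_def by (simp add: sum.If_cases Int_def)

lemma new_freq_eq_card: "new_freq X n \<omega> = card {i\<in>{1..n}. X i \<omega> = X (n + 1) \<omega>}"
  unfolding new_freq_def of_bool_def by (simp add: sum.If_cases Int_def)

text \<open>The functions are extensional, so a pattern is determined by its values on
  \<open>{1..n}\<close>: this makes the set finite and the events of distinct patterns
  disjoint.\<close>

definition hash_patterns :: "nat \<Rightarrow> nat \<Rightarrow> (nat \<Rightarrow> nat) \<Rightarrow> (nat \<Rightarrow> nat) set" where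
  "hash_patterns n J c =
     {g \<in> {1..n} \<rightarrow>\<^sub>E {1..J}. \<forall>k\<in>{1..J}. card {i\<in>{1..n}. g i = k} = c k}"

lemma finite_hash_patterns: "finite (hash_patterns n J c)"
  unfolding hash_patterns_def by (rule finite_subset[of _ "{1..n} \<rightarrow>\<^sub>E {1..J}"]) (auto intro: finite_PiE)

text \<open>The sketch counts the fibres of the map from \<open>i\<close> to
  \<open>h (X i \<omega>)\<close>; this map, restricted to \<open>{1..n}\<close>, is the
  witness.\<close>

lemma sketch_eq_iff_hash_pattern:
  assumes "\<And>s. h s \<in> {1..J}"
  shows "(\<forall>k\<in>{1..J}. sketch h X n k \<omega> = c k) \<longleftrightarrow>
    (\<exists>g\<in>hash_patterns n J c. \<forall>i\<in>{1..n}. h (X i \<omega>) = g i)"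
proof
  let ?g = "restrict (\<lambda>i. h (X i \<omega>)) {1..n}"
  assume "\<forall>k\<in>{1..J}. sketch h X n k \<omega> = c k"
  moreover have "{i\<in>{1..n}. ?g i = k} = {i\<in>{1..n}. h (X i \<omega>) = k}" for k
    by auto
  ultimately have "?g \<in> hash_patterns n J c"
    using assms by (simp add: hash_patterns_def sketch_eq_card restrict_PiE_iff)
  then show "\<exists>g\<in>hash_patterns n J c. \<forall>i\<in>{1..n}. h (X i \<omega>) = g i"
    by (intro bexI[of _ ?g]) auto
next
  assume "\<exists>g\<in>hash_patterns n J c. \<forall>i\<in>{1..n}. h (X i \<omega>) = g i"
  then obtain g where g: "g \<in> hash_patterns n J c" "\<And>i. i \<in> {1..n} \<Longrightarrow> h (X i \<omega>) = g i"
    by blast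
  then have "{i\<in>{1..n}. h (X i \<omega>) = k} = {i\<in>{1..n}. g i = k}" for k
    by auto
  with g(1) show "\<forall>k\<in>{1..J}. sketch h X n k \<omega> = c k"
    by (simp add: hash_patterns_def sketch_eq_card)
qed

lemma hash_patterns_eqI:
  assumes "g \<in> hash_patterns n J c" "g' \<in> hash_patterns n J c" "\<And>i. i \<in> {1..n} \<Longrightarrow> g i = g' i"
  shows "g = g'"
  using assms by (intro PiE_ext[of g "{1..n}" "\<lambda>_. {1..J}" g']) (simp_all add: hash_patterns_def)

section \<open>Joint probabilities of the sketch, the new symbol and its frequency\<close>

locale iid_pmf_sample = prob_space M
  for M :: "'w measure" and X :: "nat \<Rightarrow> 'w \<Rightarrow> 's" and P :: "'s pmf" and n :: nat +
  assumes iid: "iid_family M X {1..n+1} (measure_pmf P)"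
begin

lemma rv: "i \<in> {1..n+1} \<Longrightarrow> X i \<in> measurable M (count_space UNIV)"
  using iid iid_family_measure_pmf_iff[OF prob_space_axioms, of "{1..n+1}" X P] by blast

lemma prob_box:
  "K \<subseteq> {1..n+1} \<Longrightarrow>
    prob {\<omega>\<in>space M. \<forall>i\<in>K. X i \<omega> \<in> F i} = (\<Prod>i\<in>K. measure (measure_pmf P) (F i))"
  using iid iid_family_measure_pmf_iff[OF prob_space_axioms, of "{1..n+1}" X P] by blast

lemma prob_single:
  assumes "i \<in> {1..n+1}"
  shows "\<P>(\<omega> in M. X i \<omega> \<in> F) = measure (measure_pmf P) F"
  using prob_box[of "{i}" "\<lambda>_. F"] assms by simp

lemma box_events: "{\<omega>\<in>space M. (\<forall>i\<in>{1..n}. X i \<omega> \<in> F i) \<and> X (n + 1) \<omega> \<in> D} \<in> events"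
proof -
  have pred: "Measurable.pred M (\<lambda>\<omega>. X i \<omega> \<in> G)" if "i \<in> {1..n+1}" for i G
    by (rule measurable_compose[OF rv[OF that]]) simp
  have [measurable]: "Measurable.pred M (\<lambda>\<omega>. X i \<omega> \<in> F i)" if "i \<in> {1..n}" for i
    using that by (intro pred) auto
  have [measurable]: "Measurable.pred M (\<lambda>\<omega>. X (n + 1) \<omega> \<in> D)"
    by (intro pred) auto
  show ?thesis by measurable
qed

lemma prob_box_new:
  "\<P>(\<omega> in M. (\<forall>i\<in>{1..n}. X i \<omega> \<in> F i) \<and> X (n + 1) \<omega> \<in> D)
    = measure (measure_pmf P) D * (\<Prod>i\<in>{1..n}. measure (measure_pmf P) (F i))"
proof -
  have ivl: "{1..n+1} = insert (n + 1) {1..n}" by auto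
  have "{\<omega>\<in>space M. (\<forall>i\<in>{1..n}. X i \<omega> \<in> F i) \<and> X (n + 1) \<omega> \<in> D}
      = {\<omega>\<in>space M. \<forall>i\<in>{1..n+1}. X i \<omega> \<in> (if i = n + 1 then D else F i)}"
    unfolding ivl by auto
  then have "\<P>(\<omega> in M. (\<forall>i\<in>{1..n}. X i \<omega> \<in> F i) \<and> X (n + 1) \<omega> \<in> D)
      = (\<Prod>i\<in>{1..n+1}. measure (measure_pmf P) (if i = n + 1 then D else F i))"
    by (simp only: prob_box[OF order_refl])
  also have "\<dots> = measure (measure_pmf P) D *
      (\<Prod>i\<in>{1..n}. measure (measure_pmf P) (if i = n + 1 then D else F i))"
    unfolding ivl by (subst prod.insert) auto
  also have "(\<Prod>i\<in>{1..n}. measure (measure_pmf P) (if i = n + 1 then D else F i))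
      = (\<Prod>i\<in>{1..n}. measure (measure_pmf P) (F i))"
    by (intro prod.cong) auto
  finally show ?thesis .
qed

text \<open>Each pattern gives a box, and the side \<open>D\<close> of the new symbol contributes
  the same factor to all of them. With \<open>D = UNIV\<close> this yields the probability of the
  sketch, with \<open>D\<close> a bucket that of the conditioning event.\<close>

lemma prob_sketch_new:
  assumes hash: "\<And>s. h s \<in> {1..J}"
  shows "\<P>(\<omega> in M. (\<forall>k\<in>{1..J}. sketch h X n k \<omega> = c k) \<and> X (n + 1) \<omega> \<in> D)
    = measure (measure_pmf P) D * (\<Sum>g\<in>hash_patterns n J c. \<Prod>i\<in>{1..n}. bucket_mass P h (g i))"
proof -
  define E where "E g = {\<omega>\<in>space M. (\<forall>i\<in>{1..n}. X i \<omega> \<in> bucket h (g i)) \<and> X (n + 1) \<omega> \<in> D}" for g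
  have "{\<omega>\<in>space M. (\<forall>k\<in>{1..J}. sketch h X n k \<omega> = c k) \<and> X (n + 1) \<omega> \<in> D}
      = (\<Union>g\<in>hash_patterns n J c. E g)"
    unfolding sketch_eq_iff_hash_pattern[of h, OF hash] by (auto simp: E_def bucket_def)
  moreover have "disjoint_family_on E (hash_patterns n J c)"
    by (force simp: disjoint_family_on_def E_def bucket_def dest: hash_patterns_eqI)
  moreover have "E g \<in> events" for g
    unfolding E_def by (rule box_events)
  moreover have "prob (E g) = measure (measure_pmf P) D * (\<Prod>i\<in>{1..n}. bucket_mass P h (g i))" for g
    unfolding E_def prob_box_new by (simp add: bucket_mass_eq_measure)
  ultimately show ?thesis
    using finite_measure_finite_Union[OF finite_hash_patterns, of E n J c]
    by (simp add: image_subset_iff sum_distrib_left)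
qed

text \<open>Refining each pattern by the set of indices where \<open>s\<close> occurs gives boxes
  again. The last factor is the sum from \<open>prob_sketch_new\<close>, which is what lets it
  cancel later. For \<open>r\<close> above \<open>c (h s)\<close> there is no such index set, and
  the binomial coefficient is 0 as well.\<close>

lemma prob_sketch_freq_new:
  assumes hash: "\<And>s. h s \<in> {1..J}"
    and q: "0 < bucket_mass P h (h s)"
  defines "t \<equiv> pmf P s / bucket_mass P h (h s)"
  shows "\<P>(\<omega> in M. (\<forall>k\<in>{1..J}. sketch h X n k \<omega> = c k) \<and> new_freq X n \<omega> = r \<and> X (n + 1) \<omega> = s)
    = pmf P s * (real (c (h s) choose r) * t ^ r * (1 - t) ^ (c (h s) - r)) *
      (\<Sum>g\<in>hash_patterns n J c. \<Prod>i\<in>{1..n}. bucket_mass P h (g i))"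
proof -
  define j where "j = h s"
  let ?m = "measure (measure_pmf P)"
  let ?G = "hash_patterns n J c"
  define B where "B g = {i\<in>{1..n}. g i = j}" for g
  define S where "S g = {R. R \<subseteq> B g \<and> card R = r}" for g
  \<comment> \<open>\<open>R\<close> is to be the exact set of positions of \<open>s\<close>, so
    \<open>s\<close> is removed from all other sides. Where \<open>g i\<close> is another bucket the
    removal changes nothing.\<close>
  define F where "F g R i = (if i \<in> R then {s} else bucket h (g i) - {s})"
    for g :: "nat \<Rightarrow> nat" and R :: "nat set" and i
  define E where "E = (\<lambda>(g, R). {\<omega>\<in>space M. (\<forall>i\<in>{1..n}. X i \<omega> \<in> F g R i) \<and> X (n + 1) \<omega> \<in> {s}})"
  have finB: "finite (B g)" for g by (simp add: B_def)
  have finS: "finite (S g)" for g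
    unfolding S_def by (rule finite_subset[OF _ finite_Pow_iff[THEN iffD2, OF finB[of g]]]) auto
  have cardB: "card (B g) = c j" if "g \<in> ?G" for g
    using that hash[of s] by (auto simp: hash_patterns_def B_def j_def)
  have cardS: "card (S g) = c j choose r" if "g \<in> ?G" for g
    unfolding S_def using n_subsets[OF finB] cardB[OF that] by simp
  \<comment> \<open>A sample point determines its pair: \<open>R\<close> as the positions of
    \<open>s\<close>, \<open>g\<close> as the hash values. Both one inclusion below and the
    disjointness of the boxes follow from this.\<close>
  have EI: "{i\<in>{1..n}. X i \<omega> = s} = R \<and> (\<forall>i\<in>{1..n}. h (X i \<omega>) = g i)"
    if "\<omega> \<in> E (g, R)" "R \<in> S g" for \<omega> g R
  proof -
    have R: "R \<subseteq> {1..n}" "\<And>i. i \<in> R \<Longrightarrow> g i = h s"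
      using that(2) by (auto simp: S_def B_def j_def)
    have "X i \<omega> \<in> F g R i" if "i \<in> {1..n}" for i
      using that \<open>\<omega> \<in> E (g, R)\<close> by (auto simp: E_def)
    then have "(X i \<omega> = s \<longleftrightarrow> i \<in> R) \<and> h (X i \<omega>) = g i" if "i \<in> {1..n}" for i
      using that R(2)[of i] by (fastforce simp: F_def bucket_def split: if_splits)
    then show ?thesis using R(1) by auto
  qed
  have "{\<omega>\<in>space M. (\<forall>k\<in>{1..J}. sketch h X n k \<omega> = c k) \<and> new_freq X n \<omega> = r \<and> X (n + 1) \<omega> = s}
      = (\<Union>x\<in>Sigma ?G S. E x)" (is "?W = ?U")
  proof (intro equalityI subsetI)
    fix \<omega> assume W: "\<omega> \<in> ?W"
    then obtain g where g: "g \<in> ?G" "\<forall>i\<in>{1..n}. h (X i \<omega>) = g i"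
      using sketch_eq_iff_hash_pattern[of h J X n \<omega> c, OF hash] by blast
    \<comment> \<open>Since the new symbol is \<open>s\<close>, its frequency is the size of this
      set.\<close>
    let ?R = "{i\<in>{1..n}. X i \<omega> = s}"
    have "g i = h s" if "i \<in> ?R" for i
      using that g(2) by force
    then have "?R \<in> S g" "\<omega> \<in> E (g, ?R)"
      using W g(2) by (auto simp: S_def B_def j_def new_freq_eq_card E_def F_def bucket_def)
    with g(1) show "\<omega> \<in> ?U" by blast
  next
    fix \<omega> assume "\<omega> \<in> ?U"
    then obtain g R where g: "g \<in> ?G" and R: "R \<in> S g" and E: "\<omega> \<in> E (g, R)" by auto
    have "X (n + 1) \<omega> = s" "\<omega> \<in> space M" using E by (auto simp: E_def)
    moreover have "card R = r" using R by (simp add: S_def)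
    ultimately show "\<omega> \<in> ?W"
      using EI[OF E R] g sketch_eq_iff_hash_pattern[of h J X n \<omega> c, OF hash]
      by (auto simp: new_freq_eq_card)
  qed
  moreover have "disjoint_family_on E (Sigma ?G S)"
    unfolding disjoint_family_on_def
  proof (intro ballI impI)
    fix x y assume xy: "x \<in> Sigma ?G S" "y \<in> Sigma ?G S" "x \<noteq> y"
    then obtain g R g' R' where x: "x = (g, R)" "g \<in> ?G" "R \<in> S g"
      and y: "y = (g', R')" "g' \<in> ?G" "R' \<in> S g'" by blast
    show "E x \<inter> E y = {}"
    proof (rule ccontr)
      assume "E x \<inter> E y \<noteq> {}"
      then obtain \<omega> where "\<omega> \<in> E (g, R)" "\<omega> \<in> E (g', R')" using x(1) y(1) by blast
      with EI[of \<omega> g R] EI[of \<omega> g' R'] x y have "R = R'" "\<forall>i\<in>{1..n}. g i = g' i" by auto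
      then show False using x y xy(3) hash_patterns_eqI[of g n J c g'] by auto
    qed
  qed
  moreover have "E x \<in> events" for x
    unfolding E_def by (cases x) (simp only: prod.case box_events)
  ultimately have "prob ?W = (\<Sum>x\<in>Sigma ?G S. prob (E x))"
    using finite_measure_finite_Union[of "Sigma ?G S" E] finS finite_hash_patterns[of n J c]
    by (simp add: image_subset_iff)
  also have "\<dots> = (\<Sum>g\<in>?G. \<Sum>R\<in>S g. prob (E (g, R)))"
    using finS finite_hash_patterns[of n J c] by (simp add: sum.Sigma)
  also have "\<dots> = (\<Sum>g\<in>?G. \<Sum>R\<in>S g. pmf P s * (t ^ r * (1 - t) ^ (c j - r)) *
      (\<Prod>i\<in>{1..n}. bucket_mass P h (g i)))"
  proof (intro sum.cong refl)
    fix g R assume g: "g \<in> ?G" and R: "R \<in> S g"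
    have RB: "R \<subseteq> B g" and cR: "card R = r" using R by (auto simp: S_def)
    \<comment> \<open>Each side is compared with its whole bucket: the ratio of the masses is
      \<open>t\<close> on \<open>R\<close>, \<open>1 - t\<close> on the rest of \<open>B g\<close>,
      and 1 at indices hashed elsewhere.\<close>
    define u where "u i = (if i \<in> R then t else 1 - t)" for i
    have "?m (F g R i) = (if i \<in> B g then u i else 1) * bucket_mass P h (g i)"
      if "i \<in> {1..n}" for i
    proof (cases "i \<in> B g")
      case True
      then have s: "s \<in> bucket h (g i)" and gi: "g i = h s"
        by (auto simp: B_def bucket_def j_def)
      have p: "?m {s} = t * bucket_mass P h (g i)"
        using q by (simp add: t_def gi pmf.rep_eq)
      have "?m (bucket h (g i) - {s}) = bucket_mass P h (g i) - ?m {s}"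
        using s by (subst measure_pmf.finite_measure_Diff) (auto simp: bucket_mass_eq_measure)
      with True p show ?thesis
        by (simp add: F_def u_def left_diff_distrib)
    next
      case False
      then have "s \<notin> bucket h (g i)" "i \<notin> R" using that RB by (auto simp: B_def bucket_def j_def)
      then show ?thesis
        using False by (simp add: F_def bucket_mass_eq_measure)
    qed
    then have "(\<Prod>i\<in>{1..n}. ?m (F g R i))
        = (\<Prod>i\<in>{1..n}. if i \<in> B g then u i else 1) * (\<Prod>i\<in>{1..n}. bucket_mass P h (g i))"
      by (simp add: prod.distrib)
    also have "(\<Prod>i\<in>{1..n}. if i \<in> B g then u i else 1) = (\<Prod>i\<in>B g. u i)"
      by (subst prod.inter_restrict[symmetric]) (auto simp: B_def intro!: prod.cong)
    \<comment> \<open>\<open>B g\<close> has \<open>c j\<close> elements, \<open>r\<close> of which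
      lie in \<open>R\<close>. If \<open>t = 1\<close> and \<open>r = c j\<close>, the second power
      is \<open>0 ^ 0 = 1\<close>, the empty product.\<close>
    also have "\<dots> = t ^ r * (1 - t) ^ (c j - r)"
      using RB cR cardB[OF g] finB[of g] finite_subset[OF RB finB]
      by (simp add: u_def prod.If_cases Int_absorb1 Diff_eq[symmetric] card_Diff_subset)
    finally show "prob (E (g, R)) = pmf P s * (t ^ r * (1 - t) ^ (c j - r)) *
        (\<Prod>i\<in>{1..n}. bucket_mass P h (g i))"
      using prob_box_new[of "F g R" "{s}"] by (simp add: E_def pmf.rep_eq)
  qed
  also have "\<dots> = pmf P s * (real (c j choose r) * t ^ r * (1 - t) ^ (c j - r)) *
      (\<Sum>g\<in>?G. \<Prod>i\<in>{1..n}. bucket_mass P h (g i))"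
    by (simp add: cardS sum_distrib_left mult_ac)
  finally show ?thesis by (simp add: j_def)
qed

end

section \<open>The law within a bucket and the conditional law of the frequency\<close>

text \<open>Conditioning on which indices fall into the bucket is expressed by
  \<open>uniform_measure\<close> on the event that, among \<open>A\<close>, they are exactly those
  in \<open>I\<close>; \<open>A = {1..n}\<close> is the sketched sample.\<close>

theorem theorem1:
  fixes M :: "'w measure" and P :: "'s pmf" and X :: "nat \<Rightarrow> 'w \<Rightarrow> 's"
    and h :: "'s \<Rightarrow> nat" and n J j :: nat
  assumes "prob_space M" and "1 \<le> n"
    and iid: "iid_family M X {1..n+1} (measure_pmf P)"
    and freq_rv: "new_freq X n \<in> measurable M (count_space UNIV)"
    and hash: "\<And>s. h s \<in> {1..J}"
    and j: "j \<in> {1..J}" "0 < bucket_mass P h j"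
  shows "(\<forall>i\<in>{1..n+1}. \<P>(\<omega> in M. h (X i \<omega>) = j) = bucket_mass P h j) \<and>
    prob_space (bucket_law P h j) \<and>
    (\<forall>A I. A \<subseteq> {1..n+1} \<longrightarrow> \<P>(\<omega> in M. {i\<in>A. h (X i \<omega>) = j} = I) > 0 \<longrightarrow>
           iid_family (uniform_measure M {\<omega>\<in>space M. {i\<in>A. h (X i \<omega>) = j} = I}) X I
             (bucket_law P h j)) \<and>
    (\<forall>(c :: nat \<Rightarrow> nat) r.
           \<P>(\<omega> in M. \<forall>k\<in>{1..J}. sketch h X n k \<omega> = c k) > 0 \<longrightarrow> r \<le> c j \<longrightarrow>
           \<P>(\<omega> in M. new_freq X n \<omega> = r \<bar>
                (\<forall>k\<in>{1..J}. sketch h X n k \<omega> = c k) \<and> h (X (n + 1) \<omega>) = j)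
           = real (c j choose r) *
             (\<Sum>\<^sub>\<infinity>s\<in>bucket h j. (pmf P s / bucket_mass P h j) ^ (r + 1) *
                (1 - pmf P s / bucket_mass P h j) ^ (c j - r)))"
proof (intro conjI ballI allI impI)
  interpret prob_space M by fact
  interpret iid_pmf_sample M X P n by unfold_locales (rule iid)
  let ?q = "bucket_mass P h j"
  show "\<P>(\<omega> in M. h (X i \<omega>) = j) = ?q" if "i \<in> {1..n+1}" for i
    using prob_single[OF that, of "bucket h j"] by (simp add: bucket_def bucket_mass_eq_measure)
  show "prob_space (bucket_law P h j)"
    by (simp add: bucket_law_eq_cond_pmf[OF j(2)] prob_space_measure_pmf)
  show "iid_family (uniform_measure M {\<omega>\<in>space M. {i\<in>A. h (X i \<omega>) = j} = I}) X I (bucket_law P h j)"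
    if A: "A \<subseteq> {1..n+1}" and pos: "\<P>(\<omega> in M. {i\<in>A. h (X i \<omega>) = j} = I) > 0" for A I
  proof (rule iid_family_uniform_measure_bucket[OF prob_space_axioms _ _ j(2) pos])
    show "finite A" using A by (rule finite_subset) simp
    \<comment> \<open>The product formula restricts to any smaller index set.\<close>
    then show "iid_family M X A (measure_pmf P)"
      using A iid by (simp add: iid_family_measure_pmf_iff[OF prob_space_axioms] subset_iff)
  qed
  show "\<P>(\<omega> in M. new_freq X n \<omega> = r \<bar>
          (\<forall>k\<in>{1..J}. sketch h X n k \<omega> = c k) \<and> h (X (n + 1) \<omega>) = j)
      = real (c j choose r) *
        (\<Sum>\<^sub>\<infinity>s\<in>bucket h j. (pmf P s / ?q) ^ (r + 1) * (1 - pmf P s / ?q) ^ (c j - r))"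
    if pos: "\<P>(\<omega> in M. \<forall>k\<in>{1..J}. sketch h X n k \<omega> = c k) > 0" for c r
  proof -
    define Z where "Z = (\<Sum>g\<in>hash_patterns n J c. \<Prod>i\<in>{1..n}. bucket_mass P h (g i))"
    \<comment> \<open>The bucket may be uncountable; countable additivity needs the support.\<close>
    define T where "T = bucket h j \<inter> set_pmf P"
    define w where "w s = (pmf P s / ?q) ^ (r + 1) * (1 - pmf P s / ?q) ^ (c j - r)" for s
    define E where "E s = {\<omega>\<in>space M. (\<forall>k\<in>{1..J}. sketch h X n k \<omega> = c k) \<and>
      new_freq X n \<omega> = r \<and> X (n + 1) \<omega> = s}" for s
    define W where "W = {\<omega>\<in>space M. new_freq X n \<omega> = r \<and>
      (\<forall>k\<in>{1..J}. sketch h X n k \<omega> = c k) \<and> h (X (n + 1) \<omega>) = j}"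
    \<comment> \<open>With \<open>D = UNIV\<close> the probability of the sketch is \<open>Z\<close>
      itself.\<close>
    have Z: "Z > 0"
      using pos prob_sketch_new[of h J c UNIV, OF hash] by (simp add: Z_def)
    \<comment> \<open>With \<open>D\<close> the bucket, the conditioning event gets the positive
      probability \<open>?q * Z\<close>; the same factor recurs in each
      \<open>prob (E s)\<close>.\<close>
    have den: "\<P>(\<omega> in M. (\<forall>k\<in>{1..J}. sketch h X n k \<omega> = c k) \<and> h (X (n + 1) \<omega>) = j) = ?q * Z"
      using prob_sketch_new[of h J c "bucket h j", OF hash]
      by (simp add: Z_def bucket_def bucket_mass_eq_measure)
    note freq_rv[measurable]
    have [measurable]: "X i \<in> measurable M (count_space UNIV)" if "i \<in> {1..n}" for i
      using that by (intro rv) auto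
    have [measurable]: "X (n + 1) \<in> measurable M (count_space UNIV)"
      by (intro rv) auto
    have [measurable]: "sketch h X n k \<in> measurable M (count_space UNIV)" for k
      unfolding sketch_def[abs_def] of_bool_def by measurable
    have E_ev: "E s \<in> events" for s
      unfolding E_def by measurable
    \<comment> \<open>\<open>freq_rv\<close> supplies this: over an uncountable bucket
      \<open>W\<close> is an uncountable union of the slices \<open>E s\<close>, whose measurability
      alone does not give that of \<open>W\<close>.\<close>
    have W_ev: "W \<in> events"
      unfolding W_def by measurable
    \<comment> \<open>The mass \<open>pmf P s\<close> of the new symbol is \<open>?q\<close> times
      \<open>pmf P s / ?q\<close>; this extra ratio raises the exponent in \<open>w\<close> from
      \<open>r\<close> to \<open>r + 1\<close>.\<close>
    have E: "prob (E s) = ?q * Z * (real (c j choose r) * w s)" if "s \<in> T" for s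
    proof -
      have "h s = j" using that by (simp add: T_def bucket_def)
      then show ?thesis
        using prob_sketch_freq_new[of h J s c r, OF hash] j(2)
        by (simp add: E_def Z_def w_def)
    qed
    \<comment> \<open>The new symbol lies in the support almost surely, so \<open>W\<close> may be
      replaced by a countable union of slices.\<close>
    have "\<P>(\<omega> in M. X (n + 1) \<omega> \<in> set_pmf P) = 1"
      by (subst prob_single) (auto simp: measure_pmf.prob_eq_1 AE_measure_pmf_iff)
    then have "AE \<omega> in M. X (n + 1) \<omega> \<in> set_pmf P"
      by (auto dest: AE_prob_1)
    then have "prob W = prob (\<Union>s\<in>T. E s)"
    proof (intro measure_eq_AE W_ev)
      show "(\<Union>s\<in>T. E s) \<in> events"
        by (intro sets.countable_UN') (auto simp: T_def intro: E_ev)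
    qed (auto simp: W_def E_def T_def bucket_def)
    also have "\<dots> = (\<Sum>\<^sub>\<infinity>s\<in>T. prob (E s))"
      by (intro measure_UN_infsum E_ev) (auto simp: T_def E_def disjoint_family_on_def)
    also have "\<dots> = (\<Sum>\<^sub>\<infinity>s\<in>T. ?q * Z * (real (c j choose r) * w s))"
      by (intro infsum_cong E)
    also have "\<dots> = ?q * Z * (real (c j choose r) * (\<Sum>\<^sub>\<infinity>s\<in>T. w s))"
      by (simp only: infsum_cmult_right')
    \<comment> \<open>Off the support \<open>w s\<close> vanishes because the exponent
      \<open>r + 1\<close> is positive, even for \<open>r = 0\<close>.\<close>
    also have "(\<Sum>\<^sub>\<infinity>s\<in>T. w s) = (\<Sum>\<^sub>\<infinity>s\<in>bucket h j. w s)"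
      by (rule infsum_cong_neutral) (auto simp: T_def w_def set_pmf_iff)
    finally have "prob W / (?q * Z) = real (c j choose r) * (\<Sum>\<^sub>\<infinity>s\<in>bucket h j. w s)"
      using Z j(2) by simp
    then show ?thesis
      unfolding cond_prob_def den W_def w_def .
  qed
qed

end
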